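(* For every integer $m\ge 0$, the class of all groups $G$ with $\mathrm{cdim}(G)\le m$ is axiomatised by the universal sentence $\mathrm{CD}_m$ (defined in the context). That is, a group $G$ satisfies the sentence $\mathrm{CD}_m$ if and only if $\mathrm{cdim}(G)\le m$.
   Context: For a subset $S$ of a group $G$, $C_G(S)=\{g\in G: gs=sg \text{ for all } s\in S\}$ is the centraliser of $S$ in $G$; a centraliser in $G$ is a subgroup of this form. A centraliser chain of length $k$ in $G$ is a sequence $C_0>C_1>\cdots>C_k$ of centralisers in $G$ with all inclusions strict. If there is an integer $d$ such that $G$ has a centraliser chain of length $d$ and none of length greater than $d$, then the centraliser dimension of $G$ is $\mathrm{cdim}(G)=d$; if no such $d$ exists, $\mathrm{cdim}(G)=\infty$. Sentences are first-order sentences in the language of groups (multiplication, inversion, identity). The following abbreviations are used: $y\in C(x_1,\ldots,x_k)$ stands for $\bigwedge_{i=1}^k [x_i,y]=1$; $y\notin C(x_1,\ldots,x_k)$ stands for its negation; and $z\in Z$ stands for $\forall u\,([u,z]=1)$. The sentence $\mathrm{CD}_m$ is defined as follows. For $m=0$ and $m=1$, $\mathrm{CD}_0=\mathrm{CD}_1$ is the sentence $\forall x,y\,([x,y]=1)$. For $m\ge 2$, $\mathrm{CD}_m$ is the sentence $$\forall x_0,\ldots,x_m,y_1,\ldots,y_m,z\ \Big(\bigwedge_{i=1}^{m}\big(y_i\in C(x_0,\ldots,x_{i-1})\wedge y_i\notin C(x_0,\ldots,x_i)\big)\wedge z\in C(x_0,\ldots,x_m)\ \rightarrow\ z\in Z\Big).$$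 *)

theory Defs
  imports "HOL-Algebra.Group" "HOL-Library.Extended_Nat"
begin

section \<open>Centralisers and centraliser dimension\<close>

definition centraliser :: "('a, 'b) monoid_scheme \<Rightarrow> 'a set \<Rightarrow> 'a set" where
  "centraliser G S = {g \<in> carrier G. \<forall>s\<in>S. g \<otimes>\<^bsub>G\<^esub> s = s \<otimes>\<^bsub>G\<^esub> g}"

definition is_centraliser :: "('a, 'b) monoid_scheme \<Rightarrow> 'a set \<Rightarrow> bool" where
  "is_centraliser G H \<longleftrightarrow> (\<exists>S \<subseteq> carrier G. H = centraliser G S)"

text \<open>A chain of length \<open>k\<close> consists of the \<open>k + 1\<close> members \<open>C 0, \<dots>, C k\<close>; the
  values of \<open>C\<close> beyond \<open>k\<close> are irrelevant.\<close>

definition centraliser_chain :: "('a, 'b) monoid_scheme \<Rightarrow> nat \<Rightarrow> (nat \<Rightarrow> 'a set) \<Rightarrow> bool" where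
  "centraliser_chain G k C \<longleftrightarrow>
     (\<forall>i\<le>k. is_centraliser G (C i)) \<and> (\<forall>i<k. C (Suc i) \<subset> C i)"

definition max_chain_length :: "('a, 'b) monoid_scheme \<Rightarrow> nat \<Rightarrow> bool" where
  "max_chain_length G d \<longleftrightarrow>
     (\<exists>C. centraliser_chain G d C) \<and> \<not> (\<exists>k>d. \<exists>C. centraliser_chain G k C)"

definition cdim :: "('a, 'b) monoid_scheme \<Rightarrow> enat" where
  "cdim G = (if \<exists>d. max_chain_length G d then enat (THE d. max_chain_length G d) else \<infinity>)"

section \<open>First-order logic in the language of groups\<close>

datatype gterm = Var nat | Unit | Inv gterm | Mul gterm gterm

datatype formula =
    Eq gterm gterm
  | Neg formula
  | Conj formula formula
  | Disj formula formula
  | Imp formula formula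
  | Forall nat formula
  | Exists nat formula

primrec vars :: "gterm \<Rightarrow> nat set" where
  "vars (Var n) = {n}"
| "vars Unit = {}"
| "vars (Inv t) = vars t"
| "vars (Mul s t) = vars s \<union> vars t"

primrec free_vars :: "formula \<Rightarrow> nat set" where
  "free_vars (Eq s t) = vars s \<union> vars t"
| "free_vars (Neg \<phi>) = free_vars \<phi>"
| "free_vars (Conj \<phi> \<psi>) = free_vars \<phi> \<union> free_vars \<psi>"
| "free_vars (Disj \<phi> \<psi>) = free_vars \<phi> \<union> free_vars \<psi>"
| "free_vars (Imp \<phi> \<psi>) = free_vars \<phi> \<union> free_vars \<psi>"
| "free_vars (Forall n \<phi>) = free_vars \<phi> - {n}"
| "free_vars (Exists n \<phi>) = free_vars \<phi> - {n}"

definition sentence :: "formula \<Rightarrow> bool" where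
  "sentence \<phi> \<longleftrightarrow> free_vars \<phi> = {}"

text \<open>A formula need not be in prenex form to be universal: what counts is that pulling its
  quantifiers to the front yields a prefix of universal quantifiers only. Since moving a
  quantifier out of a negation or out of the antecedent of an implication dualises it, this
  means that \<open>\<forall>\<close> occurs only positively and \<open>\<exists>\<close> only negatively; dually for existential
  formulas. (\<open>CD\<close> below is not literally prenex, because of the quantifier hidden in
  \<open>z \<in> Z\<close>.)\<close>

fun universal :: "formula \<Rightarrow> bool" and existential :: "formula \<Rightarrow> bool" where
  "universal (Eq s t) \<longleftrightarrow> True"
| "universal (Neg \<phi>) \<longleftrightarrow> existential \<phi>"
| "universal (Conj \<phi> \<psi>) \<longleftrightarrow> universal \<phi> \<and> universal \<psi>"
| "universal (Disj \<phi> \<psi>) \<longleftrightarrow> universal \<phi> \<and> universal \<psi>"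
| "universal (Imp \<phi> \<psi>) \<longleftrightarrow> existential \<phi> \<and> universal \<psi>"
| "universal (Forall n \<phi>) \<longleftrightarrow> universal \<phi>"
| "universal (Exists n \<phi>) \<longleftrightarrow> False"
| "existential (Eq s t) \<longleftrightarrow> True"
| "existential (Neg \<phi>) \<longleftrightarrow> universal \<phi>"
| "existential (Conj \<phi> \<psi>) \<longleftrightarrow> existential \<phi> \<and> existential \<psi>"
| "existential (Disj \<phi> \<psi>) \<longleftrightarrow> existential \<phi> \<and> existential \<psi>"
| "existential (Imp \<phi> \<psi>) \<longleftrightarrow> universal \<phi> \<and> existential \<psi>"
| "existential (Forall n \<phi>) \<longleftrightarrow> False"
| "existential (Exists n \<phi>) \<longleftrightarrow> existential \<phi>"

primrec eval :: "('a, 'b) monoid_scheme \<Rightarrow> (nat \<Rightarrow> 'a) \<Rightarrow> gterm \<Rightarrow> 'a" where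
  "eval G e (Var n) = e n"
| "eval G e Unit = \<one>\<^bsub>G\<^esub>"
| "eval G e (Inv t) = inv\<^bsub>G\<^esub> (eval G e t)"
| "eval G e (Mul s t) = eval G e s \<otimes>\<^bsub>G\<^esub> eval G e t"

primrec sat :: "('a, 'b) monoid_scheme \<Rightarrow> (nat \<Rightarrow> 'a) \<Rightarrow> formula \<Rightarrow> bool" where
  "sat G e (Eq s t) \<longleftrightarrow> eval G e s = eval G e t"
| "sat G e (Neg \<phi>) \<longleftrightarrow> \<not> sat G e \<phi>"
| "sat G e (Conj \<phi> \<psi>) \<longleftrightarrow> sat G e \<phi> \<and> sat G e \<psi>"
| "sat G e (Disj \<phi> \<psi>) \<longleftrightarrow> sat G e \<phi> \<or> sat G e \<psi>"
| "sat G e (Imp \<phi> \<psi>) \<longleftrightarrow> (sat G e \<phi> \<longrightarrow> sat G e \<psi>)"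
| "sat G e (Forall n \<phi>) \<longleftrightarrow> (\<forall>a\<in>carrier G. sat G (e(n := a)) \<phi>)"
| "sat G e (Exists n \<phi>) \<longleftrightarrow> (\<exists>a\<in>carrier G. sat G (e(n := a)) \<phi>)"

definition models :: "('a, 'b) monoid_scheme \<Rightarrow> formula \<Rightarrow> bool"  (infix \<open>\<Turnstile>\<close> 50) where
  "G \<Turnstile> \<phi> \<longleftrightarrow> (\<forall>e. range e \<subseteq> carrier G \<longrightarrow> sat G e \<phi>)"

section \<open>The sentences \<open>CD\<close>\<close>

text \<open>The empty conjunction is rendered by the valid formula \<open>1 = 1\<close>.\<close>

definition Conjs :: "formula list \<Rightarrow> formula" where
  "Conjs \<phi>s = foldr Conj \<phi>s (Eq Unit Unit)"

definition Foralls :: "nat list \<Rightarrow> formula \<Rightarrow> formula" where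
  "Foralls ns \<phi> = foldr Forall ns \<phi>"

text \<open>\<open>[s, t] = s\<^sup>-\<^sup>1 t\<^sup>-\<^sup>1 s t\<close>\<close>

definition commutator :: "gterm \<Rightarrow> gterm \<Rightarrow> gterm" where
  "commutator s t = Mul (Mul (Mul (Inv s) (Inv t)) s) t"

definition commute :: "nat \<Rightarrow> nat \<Rightarrow> formula" where
  "commute x y = Eq (commutator (Var x) (Var y)) Unit"

text \<open>The formula \<open>y \<in> C(xs)\<close>.\<close>

definition in_C :: "nat \<Rightarrow> nat list \<Rightarrow> formula" where
  "in_C y xs = Conjs (map (\<lambda>x. commute x y) xs)"

text \<open>The formula \<open>z \<in> Z\<close>; the bound variable \<open>u\<close> is \<open>Suc z\<close>, which is distinct from \<open>z\<close>.\<close>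

definition in_Z :: "nat \<Rightarrow> formula" where
  "in_Z z = Forall (Suc z) (commute (Suc z) z)"

text \<open>For \<open>m \<ge> 2\<close>, the variables \<open>x\<^sub>0, \<dots>, x\<^sub>m, y\<^sub>1, \<dots>, y\<^sub>m, z\<close> carry the pairwise distinct indices
  \<open>0, \<dots>, m, m + 1, \<dots>, 2 * m, 2 * m + 1\<close>; note that \<open>[0..<i]\<close> ends with \<open>i - 1\<close>.\<close>

definition CD :: "nat \<Rightarrow> formula" where
  "CD m =
    (if m \<le> 1 then Forall 0 (Forall 1 (commute 0 1))
     else
       let x = (\<lambda>i. i); y = (\<lambda>i. m + i); z = 2 * m + 1 in
       Foralls (map x [0..<m + 1] @ map y [1..<m + 1] @ [z])
         (Imp
           (Conj
             (Conjs (map (\<lambda>i. Conj (in_C (y i) (map x [0..<i]))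
                                   (Neg (in_C (y i) (map x [0..<i + 1])))) [1..<m + 1]))
             (in_C z (map x [0..<m + 1])))
           (in_Z z)))"

end

theory Submission
  imports Defs
begin

text \<open>A strict chain of centralisers of length \<open>k\<close> exists iff there are elements
  \<open>x\<^sub>0, \<dots>, x\<^bsub>k-1\<^esub>\<close> and \<open>y\<^sub>0, \<dots>, y\<^bsub>k-1\<^esub>\<close> such that \<open>y\<^sub>i\<close> commutes with \<open>x\<^sub>0, \<dots>, x\<^bsub>i-1\<^esub>\<close> but not
  with \<open>x\<^sub>i\<close> (a ladder of length \<open>k\<close>). A ladder of length \<open>m + 1\<close> violates \<open>CD m\<close> if one puts
  \<open>1\<close> in front of the \<open>x\<close>'s and takes the last \<open>y\<close> for \<open>z\<close>, the last \<open>x\<close> witnessing \<open>z \<notin> Z\<close>.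
  Conversely, suppose that \<open>CD m\<close> is violated. If \<open>x\<^sub>0\<close> is not central, then some element not
  commuting with it, put in front of the \<open>y\<close>'s, completes a ladder of length \<open>m + 1\<close>; if it is
  central, then drop it and append \<open>z\<close> together with an element not commuting with \<open>z\<close>.\<close>

definition commuting_ladder ::
    "('a, 'b) monoid_scheme \<Rightarrow> nat \<Rightarrow> (nat \<Rightarrow> 'a) \<Rightarrow> (nat \<Rightarrow> 'a) \<Rightarrow> bool" where
  "commuting_ladder G k x y \<longleftrightarrow>
     (\<forall>i<k. x i \<in> carrier G \<and> y i \<in> carrier G \<and>
            (\<forall>j<i. y i \<otimes>\<^bsub>G\<^esub> x j = x j \<otimes>\<^bsub>G\<^esub> y i) \<and>
            y i \<otimes>\<^bsub>G\<^esub> x i \<noteq> x i \<otimes>\<^bsub>G\<^esub> y i)"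

lemma commuting_ladder_mono:
  "commuting_ladder G k x y \<Longrightarrow> l \<le> k \<Longrightarrow> commuting_ladder G l x y"
  by (auto simp: commuting_ladder_def)

section \<open>Centraliser chains\<close>

lemma centraliser_chain_decreasing:
  assumes "centraliser_chain G k C" and "i \<le> j" and "j \<le> k"
  shows "C j \<subseteq> C i"
  using assms(2,3)
proof (induction rule: dec_induct)
  case (step n)
  then show ?case using assms(1) unfolding centraliser_chain_def
    by (metis Suc_le_lessD dual_order.trans order_less_imp_le psubset_imp_subset)
qed simp

text \<open>Strictness gives \<open>y\<close> in \<open>C i\<close> outside
  \<open>C (Suc i)\<close>. The latter centralises some set, so an element \<open>x\<close> of that
  set fails to commute with \<open>y\<close> yet commutes with all of
  \<open>C (Suc i)\<close>.\<close>

lemma centraliser_chain_imp_ladder: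
  assumes "centraliser_chain G k C"
  obtains x y where "commuting_ladder G k x y"
proof -
  have step: "\<exists>x y. x \<in> carrier G \<and> y \<in> C i \<and> y \<in> carrier G \<and>
      (\<forall>g\<in>C (Suc i). g \<otimes>\<^bsub>G\<^esub> x = x \<otimes>\<^bsub>G\<^esub> g) \<and> y \<otimes>\<^bsub>G\<^esub> x \<noteq> x \<otimes>\<^bsub>G\<^esub> y" if "i < k" for i
  proof -
    have "is_centraliser G (C i)" "is_centraliser G (C (Suc i))" "C (Suc i) \<subset> C i"
      using assms that by (auto simp: centraliser_chain_def)
    then show ?thesis
      unfolding is_centraliser_def centraliser_def by blast
  qed
  then obtain x y where xy: "\<And>i. i < k \<Longrightarrow> x i \<in> carrier G \<and> y i \<in> C i \<and> y i \<in> carrier G \<and>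
      (\<forall>g\<in>C (Suc i). g \<otimes>\<^bsub>G\<^esub> x i = x i \<otimes>\<^bsub>G\<^esub> g) \<and> y i \<otimes>\<^bsub>G\<^esub> x i \<noteq> x i \<otimes>\<^bsub>G\<^esub> y i"
    by metis
  have "y i \<otimes>\<^bsub>G\<^esub> x j = x j \<otimes>\<^bsub>G\<^esub> y i" if "j < i" "i < k" for i j
  proof -
    \<comment> \<open>The pairs are chosen separately at each level; nesting links them:
      \<open>y i\<close> lies in \<open>C i\<close>, hence in \<open>C (Suc j)\<close>, all of which
      commutes with \<open>x j\<close>.\<close>
    have "C i \<subseteq> C (Suc j)"
      using centraliser_chain_decreasing[OF assms, of "Suc j" i] that by simp
    then show ?thesis using xy[of i] xy[of j] that by auto
  qed
  with xy have "commuting_ladder G k x y"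
    by (auto simp: commuting_ladder_def)
  then show thesis by (rule that)
qed

text \<open>The chain starts at the centraliser of the empty set, the whole group, so
  \<open>k\<close> elements give \<open>k + 1\<close> members; \<open>y i\<close> separates member
  \<open>i\<close> from the next.\<close>

lemma ladder_imp_centraliser_chain:
  assumes "commuting_ladder G k x y"
  shows "centraliser_chain G k (\<lambda>i. centraliser G (x ` {..<i}))"
  unfolding centraliser_chain_def
proof (intro conjI allI impI)
  fix i assume "i \<le> k"
  then show "is_centraliser G (centraliser G (x ` {..<i}))"
    using assms unfolding is_centraliser_def commuting_ladder_def
    by (intro exI[of _ "x ` {..<i}"]) auto
next
  fix i assume "i < k"
  then have "y i \<in> centraliser G (x ` {..<i})" "y i \<notin> centraliser G (x ` {..<Suc i})"
    using assms by (auto simp: commuting_ladder_def centraliser_def)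
  moreover have "centraliser G (x ` {..<Suc i}) \<subseteq> centraliser G (x ` {..<i})"
    by (auto simp: centraliser_def)
  ultimately show "centraliser G (x ` {..<Suc i}) \<subset> centraliser G (x ` {..<i})"
    by blast
qed

lemma ex_centraliser_chain_iff_ladder:
  "(\<exists>C. centraliser_chain G k C) \<longleftrightarrow> (\<exists>x y. commuting_ladder G k x y)"
  by (meson centraliser_chain_imp_ladder ladder_imp_centraliser_chain)

text \<open>Ladder lengths are closed downwards, so the dimension is the last length that occurs, or
  \<infinity> if there is none; testing length \<open>m + 1\<close> suffices.\<close>

lemma cdim_le_iff_no_ladder:
  "cdim G \<le> enat m \<longleftrightarrow> \<not> (\<exists>x y. commuting_ladder G (Suc m) x y)"
proof -
  define P where "P k \<longleftrightarrow> (\<exists>x y. commuting_ladder G k x y)" for k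
  have P0: "P 0"
    by (simp add: P_def commuting_ladder_def)
  have P_mono: "P l" if "P k" "l \<le> k" for k l
    using that commuting_ladder_mono unfolding P_def by metis
  have max_iff: "max_chain_length G d \<longleftrightarrow> P d \<and> \<not> P (Suc d)" for d
    unfolding max_chain_length_def ex_centraliser_chain_iff_ladder P_def[symmetric]
    using P_mono by (meson Suc_leI lessI)
  have unique: "d = d'" if "max_chain_length G d" "max_chain_length G d'" for d d'
    using that P_mono unfolding max_iff by (meson not_less_eq_eq order_antisym)
  show ?thesis
  proof (cases "\<exists>d. max_chain_length G d")
    case True
    then obtain d where d: "max_chain_length G d" by blast
    then have "(THE d. max_chain_length G d) = d"
      using unique by blast
    then have "cdim G = enat d"
      using True by (simp add: cdim_def)
    moreover have "d \<le> m \<longleftrightarrow> \<not> P (Suc m)"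
      using d P_mono unfolding max_iff by (meson Suc_le_mono not_less_eq_eq)
    ultimately show ?thesis by (simp add: P_def)
  next
    case False
    \<comment> \<open>Without a maximum, \<open>P k\<close> always implies \<open>P (Suc k)\<close>,
      so ladders of every length exist.\<close>
    then have "P k" for k
      by (induction k) (auto simp: P0 max_iff)
    then show ?thesis using False by (simp add: cdim_def P_def)
  qed
qed

section \<open>Syntax and semantics of the sentences\<close>

lemma free_vars_Conjs [simp]: "free_vars (Conjs \<phi>s) = (\<Union>\<phi>\<in>set \<phi>s. free_vars \<phi>)"
  by (induction \<phi>s) (auto simp: Conjs_def)

lemma free_vars_Foralls [simp]: "free_vars (Foralls ns \<phi>) = free_vars \<phi> - set ns"
  by (induction ns) (auto simp: Foralls_def)

lemma free_vars_commute [simp]: "free_vars (commute x y) = {x, y}"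
  by (auto simp: commute_def commutator_def)

lemma universal_Conjs [simp]: "universal (Conjs \<phi>s) \<longleftrightarrow> (\<forall>\<phi>\<in>set \<phi>s. universal \<phi>)"
  by (induction \<phi>s) (auto simp: Conjs_def)

lemma existential_Conjs [simp]: "existential (Conjs \<phi>s) \<longleftrightarrow> (\<forall>\<phi>\<in>set \<phi>s. existential \<phi>)"
  by (induction \<phi>s) (auto simp: Conjs_def)

lemma universal_Foralls [simp]: "universal (Foralls ns \<phi>) \<longleftrightarrow> universal \<phi>"
  by (induction ns) (auto simp: Foralls_def)

lemma sat_Conjs [simp]: "sat G e (Conjs \<phi>s) \<longleftrightarrow> (\<forall>\<phi>\<in>set \<phi>s. sat G e \<phi>)"
  by (induction \<phi>s) (auto simp: Conjs_def)

text \<open>An arbitrary assignment already gives variable \<open>n\<close> an arbitrary value. This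
  removes the quantifier prefix of \<open>CD\<close>.\<close>

lemma models_Forall [simp]: "G \<Turnstile> Forall n \<phi> \<longleftrightarrow> G \<Turnstile> \<phi>"
proof
  assume all: "G \<Turnstile> Forall n \<phi>"
  show "G \<Turnstile> \<phi>" unfolding models_def
  proof (intro allI impI)
    fix e :: "nat \<Rightarrow> 'a" assume e: "range e \<subseteq> carrier G"
    then have "e n \<in> carrier G"
      by auto
    with all e have "sat G (e(n := e n)) \<phi>"
      unfolding models_def sat.simps by blast
    then show "sat G e \<phi>" by simp
  qed
next
  assume "G \<Turnstile> \<phi>"
  moreover have "range (e(n := a)) \<subseteq> carrier G"
    if "range e \<subseteq> carrier G" "a \<in> carrier G" for e :: "nat \<Rightarrow> 'a" and a
    using that by auto
  ultimately show "G \<Turnstile> Forall n \<phi>"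
    unfolding models_def sat.simps by blast
qed

lemma models_Foralls [simp]: "G \<Turnstile> Foralls ns \<phi> \<longleftrightarrow> G \<Turnstile> \<phi>"
  by (induction ns) (auto simp: Foralls_def)

text \<open>The commutator equals
  \<open>inv (y \<otimes> x) \<otimes> (x \<otimes> y)\<close>.\<close>

lemma (in group) commutator_eq_one_iff:
  assumes "x \<in> carrier G" "y \<in> carrier G"
  shows "inv x \<otimes> inv y \<otimes> x \<otimes> y = \<one> \<longleftrightarrow> y \<otimes> x = x \<otimes> y"
proof -
  have "inv x \<otimes> inv y \<otimes> x \<otimes> y = inv (y \<otimes> x) \<otimes> (x \<otimes> y)"
    using assms by (simp add: inv_mult_group m_assoc)
  then show ?thesis
    using assms by (metis inv_closed inv_equality inv_inv l_inv m_closed)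
qed

lemma (in group) sat_commute [simp]:
  assumes "e x \<in> carrier G" "e y \<in> carrier G"
  shows "sat G e (commute x y) \<longleftrightarrow> e y \<otimes> e x = e x \<otimes> e y"
  using commutator_eq_one_iff[OF assms] by (simp add: commute_def commutator_def)

lemma (in group) sat_in_C [simp]:
  assumes "range e \<subseteq> carrier G"
  shows "sat G e (in_C y xs) \<longleftrightarrow> (\<forall>x\<in>set xs. e y \<otimes> e x = e x \<otimes> e y)"
proof -
  have "e n \<in> carrier G" for n
    using assms by auto
  then show ?thesis by (simp add: in_C_def)
qed

lemma (in group) sat_in_Z [simp]:
  assumes "range e \<subseteq> carrier G"
  shows "sat G e (in_Z z) \<longleftrightarrow> (\<forall>u\<in>carrier G. e z \<otimes> u = u \<otimes> e z)"
proof -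
  have "e n \<in> carrier G" for n
    using assms by auto
  then show ?thesis by (simp add: in_Z_def)
qed

lemma sentence_CD: "sentence (CD m)"
proof (cases "m \<le> 1")
  case True
  then show ?thesis by (auto simp: sentence_def CD_def)
next
  case False
  \<comment> \<open>The blocks of x's and y's in the prefix cover all indices up to
    \<open>2 * m\<close>; only \<open>z\<close>, of index \<open>2 * m + 1\<close>, remains.\<close>
  have "n \<in> {..m} \<union> (\<lambda>i. m + i) ` {1..m}" if "n \<le> 2 * m" for n
  proof (cases "n \<le> m")
    case False
    then show ?thesis using that by (intro UnI2 image_eqI[of _ _ "n - m"]) auto
  qed simp
  with False show ?thesis
    unfolding sentence_def CD_def Let_def
    by (auto simp: in_C_def in_Z_def)
qed

lemma universal_CD: "universal (CD m)"
  by (auto simp: CD_def Let_def in_C_def in_Z_def commute_def)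

lemma (in group) models_CD_small:
  assumes "m \<le> 1"
  shows "G \<Turnstile> CD m \<longleftrightarrow> (\<forall>x\<in>carrier G. \<forall>y\<in>carrier G. y \<otimes> x = x \<otimes> y)"
proof -
  have "sat G e (Forall 0 (Forall 1 (commute 0 1))) \<longleftrightarrow>
      (\<forall>x\<in>carrier G. \<forall>y\<in>carrier G. y \<otimes> x = x \<otimes> y)" for e
    by simp
  \<comment> \<open>An assignment into the carrier exists, so truth under all assignments is not
    vacuous.\<close>
  moreover have "range (\<lambda>_. \<one>) \<subseteq> carrier G"
    by auto
  ultimately show ?thesis
    using assms unfolding models_def CD_def by auto
qed

lemma (in group) models_CD_large:
  assumes "2 \<le> m"
  shows "G \<Turnstile> CD m \<longleftrightarrow>
    (\<forall>e. range e \<subseteq> carrier G \<longrightarrow>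
      (\<forall>i\<in>{1..m}. (\<forall>j<i. e (m + i) \<otimes> e j = e j \<otimes> e (m + i)) \<and>
                   e (m + i) \<otimes> e i \<noteq> e i \<otimes> e (m + i)) \<longrightarrow>
      (\<forall>j\<le>m. e (2 * m + 1) \<otimes> e j = e j \<otimes> e (2 * m + 1)) \<longrightarrow>
      (\<forall>u\<in>carrier G. e (2 * m + 1) \<otimes> u = u \<otimes> e (2 * m + 1)))"
    (is "_ \<longleftrightarrow> (\<forall>e. _ \<longrightarrow> ?R e)")
proof -
  have large: "\<not> m \<le> 1"
    using assms by simp
  have set_eq: "set [Suc 0..<Suc n] = {Suc 0..n}" "set [0..<n] = {..<n}" for n
    by auto
  have bounded: "(\<forall>j\<in>{..<n}. P j) \<longleftrightarrow> (\<forall>j<n. P j)" "(\<exists>j\<in>{..<n}. P j) \<longleftrightarrow> (\<exists>j<n. P j)"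
    for n :: nat and P
    by auto
  \<comment> \<open>Reduces non-membership in \<open>C(x_0, ..., x_i)\<close> to failure at
    \<open>x_i\<close>, the form used in ladders.\<close>
  have first_failure: "(\<forall>j<i. P j) \<and> \<not> (\<forall>j\<le>i. P j) \<longleftrightarrow> (\<forall>j<i. P j) \<and> \<not> P i"
    for i :: nat and P
    by (auto simp: le_less)
  have "G \<Turnstile> CD m \<longleftrightarrow> (\<forall>e. range e \<subseteq> carrier G \<longrightarrow>
      ((\<forall>i\<in>{1..m}. (\<forall>j<i. e (m + i) \<otimes> e j = e j \<otimes> e (m + i)) \<and>
         \<not> (\<forall>j<i + 1. e (m + i) \<otimes> e j = e j \<otimes> e (m + i))) \<and>
       (\<forall>j<m + 1. e (2 * m + 1) \<otimes> e j = e j \<otimes> e (2 * m + 1)) \<longrightarrow>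
       (\<forall>u\<in>carrier G. e (2 * m + 1) \<otimes> u = u \<otimes> e (2 * m + 1))))"
    unfolding CD_def Let_def if_not_P[OF large] models_Foralls unfolding models_def
    by (intro all_cong1 imp_cong refl) (simp add: set_eq bounded del: upt_Suc set_upt)
  also have "\<dots> \<longleftrightarrow> (\<forall>e. range e \<subseteq> carrier G \<longrightarrow> ?R e)"
    by (simp only: first_failure imp_conjL less_Suc_eq_le flip: Suc_eq_plus1)
  finally show ?thesis .
qed

section \<open>Ladders and the sentences\<close>

text \<open>Two non-commuting elements already give a ladder of length 2, so dimension 1 never
  occurs; hence \<open>CD 0\<close> and \<open>CD 1\<close> agree.\<close>

lemma (in group) no_ladder_iff_commutative:
  assumes "m \<le> 1"
  shows "\<not> (\<exists>x y. commuting_ladder G (Suc m) x y) \<longleftrightarrow>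
    (\<forall>x\<in>carrier G. \<forall>y\<in>carrier G. y \<otimes> x = x \<otimes> y)"
proof
  assume none: "\<not> (\<exists>x y. commuting_ladder G (Suc m) x y)"
  show "\<forall>x\<in>carrier G. \<forall>y\<in>carrier G. y \<otimes> x = x \<otimes> y"
  proof (rule ccontr)
    assume "\<not> ?thesis"
    then obtain a b where "a \<in> carrier G" "b \<in> carrier G" "b \<otimes> a \<noteq> a \<otimes> b"
      by blast
    \<comment> \<open>The x's are \<open>a, b\<close> and the y's \<open>b, a\<close>: the second y
      equals the first x, so these two commute.\<close>
    then have "commuting_ladder G 2 (\<lambda>i. if i = 0 then a else b) (\<lambda>i. if i = 0 then b else a)"
      by (auto simp: commuting_ladder_def less_2_cases_iff)
    then show False
      using none assms commuting_ladder_mono[of G 2 _ _ "Suc m"] by auto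
  qed
qed (auto simp: commuting_ladder_def)

lemma (in group) models_CD_imp_no_ladder:
  assumes m: "2 \<le> m" and CD: "G \<Turnstile> CD m"
  shows "\<not> commuting_ladder G (Suc m) x y"
proof
  assume "commuting_ladder G (Suc m) x y"
  then have ladder: "x i \<in> carrier G" "y i \<in> carrier G"
      "j < i \<Longrightarrow> y i \<otimes> x j = x j \<otimes> y i" "y i \<otimes> x i \<noteq> x i \<otimes> y i" if "i \<le> m" for i j
    using that by (auto simp: commuting_ladder_def)
  define e where "e n =
    (if n = 0 then \<one> else if n \<le> m then x (n - 1)
     else if n \<le> 2 * m + 1 then y (n - m - 1) else \<one>)" for n
  have "range e \<subseteq> carrier G"
    using ladder by (auto simp: e_def)
  moreover have e_y: "e (m + i) = y (i - 1)" if "1 \<le> i" "i \<le> m + 1" for i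
    using that by (auto simp: e_def)
  \<comment> \<open>Here \<open>j = i\<close> is allowed because of the shift: \<open>e j\<close> is
    \<one> or \<open>x (j - 1)\<close>.\<close>
  moreover have comm: "y i \<otimes> e j = e j \<otimes> y i" if "j \<le> i" "i \<le> m" for i j
    using that ladder by (auto simp: e_def)
  moreover have "e (m + i) \<otimes> e i \<noteq> e i \<otimes> e (m + i)" if "i \<in> {1..m}" for i
    using that e_y[of i] ladder(4)[of "i - 1"] by (cases i) (auto simp: e_def)
  moreover have "e (m + i) \<otimes> e j = e j \<otimes> e (m + i)" if "i \<in> {1..m}" "j < i" for i j
    using that e_y[of i] comm[of j "i - 1"] by auto
  moreover have e_z: "e (2 * m + 1) = y m"
    by (auto simp: e_def)
  \<comment> \<open>\<open>CD m\<close> makes \<open>z = y m\<close> central; this is applied to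
    \<open>x m\<close>.\<close>
  ultimately have "y m \<otimes> x m = x m \<otimes> y m"
    using CD ladder(1)[of m] comm unfolding models_CD_large[OF m]
    by (metis le_refl)
  then show False
    using ladder(4)[of m] by simp
qed

lemma (in group) no_ladder_imp_models_CD:
  assumes m: "2 \<le> m" and none: "\<not> (\<exists>x y. commuting_ladder G (Suc m) x y)"
  shows "G \<Turnstile> CD m"
  unfolding models_CD_large[OF m]
proof (intro allI impI ballI)
  fix e :: "nat \<Rightarrow> 'a" and u
  assume "range e \<subseteq> carrier G"
  then have e: "e n \<in> carrier G" for n
    by auto
  assume y: "\<forall>i\<in>{1..m}. (\<forall>j<i. e (m + i) \<otimes> e j = e j \<otimes> e (m + i)) \<and>
      e (m + i) \<otimes> e i \<noteq> e i \<otimes> e (m + i)"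
    and z: "\<forall>j\<le>m. e (2 * m + 1) \<otimes> e j = e j \<otimes> e (2 * m + 1)"
    and u: "u \<in> carrier G"
  have central: "v \<otimes> e 0 = e 0 \<otimes> v" if v: "v \<in> carrier G" for v
  proof (rule ccontr)
    assume "v \<otimes> e 0 \<noteq> e 0 \<otimes> v"
    \<comment> \<open>At position 0 a ladder demands only that the pair fail to commute, so
      \<open>v\<close> can serve as the missing first y.\<close>
    then have "commuting_ladder G (Suc m) e (\<lambda>i. if i = 0 then v else e (m + i))"
      using y e v by (auto simp: commuting_ladder_def)
    with none show False by blast
  qed
  show "e (2 * m + 1) \<otimes> u = u \<otimes> e (2 * m + 1)"
  proof (rule ccontr)
    assume "e (2 * m + 1) \<otimes> u \<noteq> u \<otimes> e (2 * m + 1)"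
    moreover have "(\<forall>j<i. e (m + Suc i) \<otimes> e (Suc j) = e (Suc j) \<otimes> e (m + Suc i)) \<and>
        e (m + Suc i) \<otimes> e (Suc i) \<noteq> e (Suc i) \<otimes> e (m + Suc i)" if "i < m" for i
      using bspec[OF y, of "Suc i"] that by auto
    \<comment> \<open>Position \<open>i\<close> uses variables \<open>i + 1\<close> and
      \<open>m + i + 1\<close>. At \<open>i = m\<close> the y is variable \<open>2 * m + 1\<close>,
      that is \<open>z\<close>, paired with \<open>u\<close>.\<close>
    ultimately have "commuting_ladder G (Suc m) (\<lambda>i. if i < m then e (Suc i) else u)
        (\<lambda>i. e (m + Suc i))"
      using z e u by (auto simp: commuting_ladder_def less_Suc_eq mult_2)
    with none show False by blast
  qed
qed

theorem proposition3p4: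
  fixes m :: nat and G :: "('a, 'b) monoid_scheme"
  assumes "group G"
  shows "sentence (CD m) \<and> universal (CD m) \<and> (G \<Turnstile> CD m \<longleftrightarrow> cdim G \<le> enat m)"
proof -
  interpret group G by fact
  have "G \<Turnstile> CD m \<longleftrightarrow> \<not> (\<exists>x y. commuting_ladder G (Suc m) x y)"
  proof (cases "m \<le> 1")
    case True
    then show ?thesis
      using models_CD_small no_ladder_iff_commutative by blast
  next
    case False
    then have "2 \<le> m" by simp
    then show ?thesis
      using models_CD_imp_no_ladder no_ladder_imp_models_CD by blast
  qed
  then show ?thesis
    by (simp add: sentence_CD universal_CD cdim_le_iff_no_ladder)
qed

end
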